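(* Let $1\le q\le n$, let $v\in\mathbb{R}^n$ have all entries positive, let $X\in\mathcal{F}_v$, and let $X_\perp\in\mathbb{R}^{n\times(n-q)}$ be such that $(X\ X_\perp)$ is an orthogonal matrix. Let $(\mathbf{e}_1,\dots,\mathbf{e}_q)$ be the canonical basis of $\mathbb{R}^q$, $(\tilde{\mathbf{e}}_1,\dots,\tilde{\mathbf{e}}_{n-q})$ the canonical basis of $\mathbb{R}^{n-q}$, and $\tilde v=v/\|v\|$. Then the set $$\{X\mathbf{e}_i\mathbf{e}_i^T: i=1,\dots,q\}\ \cup\ \Big\{\tfrac{1}{\sqrt2}X(\mathbf{e}_i\mathbf{e}_j^T+\mathbf{e}_j\mathbf{e}_i^T): i=1,\dots,q,\ j=i+1,\dots,q\Big\}\ \cup\ \{X_\perp\tilde{\mathbf{e}}_i\tilde v^TX: i=1,\dots,n-q\}$$ is an orthonormal basis of the normal space $\mathrm{N}_X\mathcal{F}_v$ with respect to the Euclidean metric $\langle U,V\rangle=\mathrm{trace}(U^TV)$ on $\mathbb{R}^{n\times q}$.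
   Context: $\mathcal{F}_v=\{X\in\mathbb{R}^{n\times q}:X^TX=I_q,\ v\in\mathrm{span}(X)\}$, where $\mathrm{span}(X)$ is the column space of $X$; it is an embedded submanifold of $\mathbb{R}^{n\times q}$. Its normal space at $X$, i.e. the orthogonal complement in $\mathbb{R}^{n\times q}$ (with the Euclidean metric) of its tangent space at $X$, is $\mathrm{N}_X\mathcal{F}_v=\{XS+X_\perp uv^TX: S=S^T\in\mathbb{R}^{q\times q},\ u\in\mathbb{R}^{n-q}\}$. *)

theory Defs
  imports "Jordan_Normal_Form.VS_Connect"
begin

text \<open>Matrices and vectors with explicit dimensions are used because \<open>X\<^sub>\<bottom>\<close> has
  \<open>n - q\<close> columns, and \<open>n - q = 0\<close> is allowed. Indices start at \<open>0\<close>.\<close>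

definition mat_trace :: "real mat \<Rightarrow> real" where
  "mat_trace A = (\<Sum>i<dim_row A. A $$ (i, i))"

definition frob_inner :: "real mat \<Rightarrow> real mat \<Rightarrow> real" where
  "frob_inner U V = mat_trace (U\<^sup>T * V)"

definition euclid_norm :: "real vec \<Rightarrow> real" where
  "euclid_norm v = sqrt (v \<bullet> v)"

text \<open>The matrix \<open>u w\<^sup>T\<close>: \<^const>\<open>mat_of_row\<close> turns a vector into a one-row matrix.\<close>

definition outer_prod :: "real vec \<Rightarrow> real vec \<Rightarrow> real mat" where
  "outer_prod u w = (mat_of_row u)\<^sup>T * mat_of_row w"

definition real_orthogonal_mat :: "real mat \<Rightarrow> bool" where
  "real_orthogonal_mat A \<longleftrightarrow> square_mat A \<and> inverts_mat A\<^sup>T A \<and> inverts_mat A A\<^sup>T"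

definition hconcat_mat :: "real mat \<Rightarrow> real mat \<Rightarrow> real mat" where
  "hconcat_mat A B = mat_of_cols (dim_row A) (cols A @ cols B)"

definition Fv :: "nat \<Rightarrow> nat \<Rightarrow> real vec \<Rightarrow> real mat set" where
  "Fv n q v = {X \<in> carrier_mat n q. X\<^sup>T * X = 1\<^sub>m q \<and> v \<in> vec_space.col_space n X}"

text \<open>\<open>C\<^sup>\<infinity>\<close> on the open set \<open>S\<close>: \<open>D k\<close> is the \<open>k\<close>-th derivative of \<open>f\<close>.\<close>

definition smooth_on_reals :: "real set \<Rightarrow> (real \<Rightarrow> real) \<Rightarrow> bool" where
  "smooth_on_reals S f \<longleftrightarrow>
     (\<exists>D :: nat \<Rightarrow> real \<Rightarrow> real. D 0 = f \<and>
        (\<forall>k. \<forall>t\<in>S. (D k has_real_derivative D (Suc k) t) (at t)))"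

text \<open>For an embedded submanifold \<open>M\<close> of the \<open>n \<times> q\<close> matrices, the tangent space at \<open>X\<close> is the
  set of velocities at time \<open>0\<close> of the smooth curves in \<open>M\<close> through \<open>X\<close>. Smoothness and
  velocity are taken entrywise.\<close>

definition tangent_space :: "nat \<Rightarrow> nat \<Rightarrow> real mat set \<Rightarrow> real mat \<Rightarrow> real mat set" where
  "tangent_space n q M X =
     {Z \<in> carrier_mat n q. \<exists>(\<gamma> :: real \<Rightarrow> real mat) \<epsilon>. \<epsilon> > 0 \<and> \<gamma> 0 = X \<and>
        (\<forall>t\<in>{-\<epsilon><..<\<epsilon>}. \<gamma> t \<in> M) \<and>
        (\<forall>i<n. \<forall>j<q. smooth_on_reals {-\<epsilon><..<\<epsilon>} (\<lambda>t. \<gamma> t $$ (i, j)) \<and>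
           ((\<lambda>t. \<gamma> t $$ (i, j)) has_real_derivative Z $$ (i, j)) (at 0))}"

definition normal_space :: "nat \<Rightarrow> nat \<Rightarrow> real mat set \<Rightarrow> real mat \<Rightarrow> real mat set" where
  "normal_space n q M X =
     {W \<in> carrier_mat n q. \<forall>Z \<in> tangent_space n q M X. frob_inner W Z = 0}"

text \<open>The record update restricts the vector space of all \<open>n \<times> q\<close> matrices to its
  subspace \<open>N\<close>.\<close>

definition is_orthonormal_basis :: "nat \<Rightarrow> nat \<Rightarrow> real mat set \<Rightarrow> real mat set \<Rightarrow> bool" where
  "is_orthonormal_basis n q N B \<longleftrightarrow>
     subspace class_ring N (module_mat TYPE(real) n q) \<and>
     vectorspace.basis class_ring ((module_mat TYPE(real) n q)\<lparr>carrier := N\<rparr>) B \<and>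
     (\<forall>U\<in>B. \<forall>V\<in>B. frob_inner U V = (if U = V then 1 else 0))"

end

theory Submission
  imports Defs
begin

text \<open>The proposed basis is an orthonormal family \<open>B\<close> of normal vectors: a curve \<open>Y\<close> in
  \<open>\<F>\<^sub>v\<close> satisfies \<open>Y\<^sup>T Y = I\<close> and \<open>Y Y\<^sup>T v = v\<close>, and differentiating these at \<open>X\<close> shows that every
  velocity \<open>Z\<close> has \<open>X\<^sup>T Z\<close> skew and \<open>X\<^sub>\<bottom>\<^sup>T Z X\<^sup>T v = 0\<close>. By Fourier expansion it then suffices that a
  normal vector \<open>W\<close> orthogonal to \<open>B\<close> vanishes. Plane rotations of two columns of \<open>X\<close> are curves
  in \<open>\<F>\<^sub>v\<close>, so \<open>X\<^sup>T W\<close> is symmetric, hence zero by orthogonality to \<open>B\<close>. If \<open>y\<close> is a unit vector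
  orthogonal to \<open>w = X\<^sup>T v\<close> and \<open>z\<close> is a column of \<open>X\<^sub>\<bottom>\<close>, then \<open>X + ((cos t - 1) X y + sin t z) y\<^sup>T\<close>
  is a curve in \<open>\<F>\<^sub>v\<close> too, so the rows of \<open>X\<^sub>\<bottom>\<^sup>T W\<close> are orthogonal to all such \<open>y\<close>. They are
  orthogonal to \<open>w\<close> because \<open>W\<close> is orthogonal to \<open>B\<close>, so they vanish and \<open>W = 0\<close>.\<close>

section \<open>Outer products and the Frobenius inner product\<close>

lemma outer_prod_carrier [simp]:
  "u \<in> carrier_vec n \<Longrightarrow> w \<in> carrier_vec m \<Longrightarrow> outer_prod u w \<in> carrier_mat n m"
  unfolding outer_prod_def by (intro carrier_matI) auto

lemma dim_outer_prod [simp]: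
  "dim_row (outer_prod u w) = dim_vec u" "dim_col (outer_prod u w) = dim_vec w"
  unfolding outer_prod_def by auto

lemma outer_prod_index [simp]:
  "i < dim_vec u \<Longrightarrow> j < dim_vec w \<Longrightarrow> outer_prod u w $$ (i, j) = u $ i * w $ j"
  unfolding outer_prod_def by (simp add: scalar_prod_def)

lemma outer_prod_mult_vec:
  "u \<in> carrier_vec n \<Longrightarrow> w \<in> carrier_vec m \<Longrightarrow> x \<in> carrier_vec m \<Longrightarrow>
    outer_prod u w *\<^sub>v x = (w \<bullet> x) \<cdot>\<^sub>v u"
  by (intro eq_vecI)
    (auto simp: scalar_prod_def outer_prod_def sum_distrib_left sum_distrib_right mult_ac intro!: sum.cong)

lemma outer_prod_mult:
  "u \<in> carrier_vec n \<Longrightarrow> w \<in> carrier_vec m \<Longrightarrow> A \<in> carrier_mat m k \<Longrightarrow>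
    outer_prod u w * A = outer_prod u (A\<^sup>T *\<^sub>v w)"
  unfolding outer_prod_def
  by (intro eq_matI) (auto simp: scalar_prod_def sum_distrib_left mult_ac intro!: sum.cong)

lemma mult_unit_vec: "A \<in> carrier_mat n m \<Longrightarrow> j < m \<Longrightarrow> A *\<^sub>v unit_vec m j = col A j"
  for A :: "real mat"
  by (intro eq_vecI) auto

lemma smult_mat_mult_vec:
  "A \<in> carrier_mat n m \<Longrightarrow> x \<in> carrier_vec m \<Longrightarrow> (c \<cdot>\<^sub>m A) *\<^sub>v x = c \<cdot>\<^sub>v (A *\<^sub>v x)"
  for A :: "real mat"
  by (intro eq_vecI) auto

lemma frob_inner_sum:
  assumes "U \<in> carrier_mat n m" "V \<in> carrier_mat n m"
  shows "frob_inner U V = (\<Sum>j<m. \<Sum>i<n. U $$ (i, j) * V $$ (i, j))"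
  using assms unfolding frob_inner_def mat_trace_def
  by (auto simp: scalar_prod_def lessThan_atLeast0 intro!: sum.cong)

lemma frob_inner_commute:
  "U \<in> carrier_mat n m \<Longrightarrow> V \<in> carrier_mat n m \<Longrightarrow> frob_inner U V = frob_inner V U"
  by (simp add: frob_inner_sum mult.commute)

lemma frob_inner_add_left:
  "U \<in> carrier_mat n m \<Longrightarrow> U' \<in> carrier_mat n m \<Longrightarrow> V \<in> carrier_mat n m \<Longrightarrow>
    frob_inner (U + U') V = frob_inner U V + frob_inner U' V"
  by (simp add: frob_inner_sum[of _ n m] sum.distrib algebra_simps)

lemma frob_inner_smult_left:
  "U \<in> carrier_mat n m \<Longrightarrow> V \<in> carrier_mat n m \<Longrightarrow>
    frob_inner (a \<cdot>\<^sub>m U) V = a * frob_inner U V"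
  by (simp add: frob_inner_sum[of _ n m] sum_distrib_left algebra_simps)

lemma frob_inner_minus_left:
  "U \<in> carrier_mat n m \<Longrightarrow> U' \<in> carrier_mat n m \<Longrightarrow> V \<in> carrier_mat n m \<Longrightarrow>
    frob_inner (U - U') V = frob_inner U V - frob_inner U' V"
  by (simp add: frob_inner_sum[of _ n m] minus_carrier_mat sum_subtractf left_diff_distrib)

lemma frob_inner_zero_left: "V \<in> carrier_mat n m \<Longrightarrow> frob_inner (0\<^sub>m n m) V = 0"
  by (simp add: frob_inner_sum[of _ n m])

lemma frob_inner_outer_prod:
  assumes "u \<in> carrier_vec n" "w \<in> carrier_vec m" "M \<in> carrier_mat n m"
  shows "frob_inner (outer_prod u w) M = u \<bullet> (M *\<^sub>v w)"
proof -
  have "frob_inner (outer_prod u w) M = (\<Sum>j<m. \<Sum>i<n. u $ i * (M $$ (i, j) * w $ j))"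
    using assms by (subst frob_inner_sum[of _ n m]) (auto intro!: sum.cong)
  also have "\<dots> = u \<bullet> (M *\<^sub>v w)"
    using assms by (subst sum.swap)
      (auto simp: scalar_prod_def sum_distrib_left lessThan_atLeast0 intro!: sum.cong)
  finally show ?thesis .
qed

text \<open>Left multiplication by \<open>A\<close> has adjoint left multiplication by
  \<open>A^T\<close>. This lets pairings with \<open>X S\<close> and \<open>Xp S\<close> be read off
  from the blocks \<open>X^T V\<close> and \<open>Xp^T V\<close>.\<close>

lemma frob_inner_mult_left:
  assumes "A \<in> carrier_mat n k" "M \<in> carrier_mat k m" "V \<in> carrier_mat n m"
  shows "frob_inner (A * M) V = frob_inner M (A\<^sup>T * V)"
  using assms unfolding frob_inner_def
  by (simp add: transpose_mult[of A n k M m] assoc_mult_mat[of _ m k _ n _ m])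

section \<open>Orthonormal bases from complete orthonormal families\<close>

lemma frob_inner_lincomb:
  assumes "finite A" "A \<subseteq> carrier_mat n m" "V \<in> carrier_mat n m"
  shows "frob_inner (module.lincomb (module_mat TYPE(real) n m) c A) V
    = (\<Sum>U\<in>A. c U * frob_inner U V)"
  using assms
proof (induction A rule: finite_induct)
  interpret matrix_vs n m "TYPE(real)" .
  case empty
  then show ?case by (simp add: lincomb_def frob_inner_zero_left module_mat_simps)
next
  interpret matrix_vs n m "TYPE(real)" .
  case (insert U A)
  have "lincomb c A \<in> carrier_mat n m" using insert by auto
  moreover have "lincomb c (insert U A) = c U \<cdot>\<^sub>m U + lincomb c A"
    using insert by (subst lincomb_insert2) auto
  ultimately show ?case
    using insert by (simp add: frob_inner_add_left[of _ n m] frob_inner_smult_left[of _ n m])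
qed

text \<open>Pairing a linear combination with a member of the family returns its coefficient, which
  gives linear independence. For spanning, \<open>W\<close> minus its Fourier expansion lies in
  \<open>N\<close> and is orthogonal to the family, so \<open>complete\<close> makes it
  zero.\<close>

lemma is_orthonormal_basisI:
  assumes N: "subspace class_ring N (module_mat TYPE(real) n q)"
    and finI: "finite I" and sub: "f ` I \<subseteq> N"
    and orth: "\<And>a b. a \<in> I \<Longrightarrow> b \<in> I \<Longrightarrow> frob_inner (f a) (f b) = (if a = b then 1 else 0)"
    and complete: "\<And>W. W \<in> N \<Longrightarrow> (\<And>a. a \<in> I \<Longrightarrow> frob_inner (f a) W = 0) \<Longrightarrow> W = 0\<^sub>m n q"
  shows "is_orthonormal_basis n q N (f ` I)"
proof -
  interpret matrix_vs n q "TYPE(real)" .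
  interpret vsN: vectorspace class_ring "(module_mat TYPE(real) n q)\<lparr>carrier := N\<rparr>"
    by (rule subspace_is_vs[OF N])
  have subm: "submodule class_ring N (module_mat TYPE(real) n q)"
    using N by (rule is_module)
  have NC: "N \<subseteq> carrier_mat n q"
    using submodule.subset[OF subm] by (simp add: module_mat_simps)
  note C = subset_trans[OF sub NC]
  let ?B = "f ` I"
  have orthB: "frob_inner U V = (if U = V then 1 else 0)" if UV: "U \<in> ?B" "V \<in> ?B" for U V
  proof -
    obtain a b where ab: "a \<in> I" "b \<in> I" "U = f a" "V = f b" using UV by auto
    \<comment> \<open>If \<open>f\<close> identified two distinct indices, one inner product would
      be both 1 and 0. So equality of matrices agrees with equality of indices.\<close>
    have "f a \<noteq> f b" if "a \<noteq> b"
    proof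
      assume "f a = f b"
      then have "frob_inner (f a) (f a) = frob_inner (f a) (f b)" by simp
      then show False using orth ab that by auto
    qed
    then show ?thesis using orth ab by auto
  qed
  have finB: "finite ?B" using finI by simp
  have coeff: "frob_inner (lincomb c ?B) V = c V" if "V \<in> ?B" for c V
  proof -
    have "frob_inner (lincomb c ?B) V = (\<Sum>U\<in>?B. c U * frob_inner U V)"
      using that C by (intro frob_inner_lincomb finB) auto
    also have "\<dots> = (\<Sum>U\<in>?B. if U = V then c U else 0)"
      using orthB[OF _ that] by (intro sum.cong) auto
    also have "\<dots> = c V" using that finB by simp
    finally show ?thesis .
  qed
  have li: "lin_indpt ?B"
  proof (rule finite_lin_indpt2[OF finB C])
    fix c :: "real mat \<Rightarrow> real" assume "lincomb c ?B = 0\<^sub>m n q"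
    then show "\<forall>V\<in>?B. c V = 0"
      using coeff[of _ c] C by (metis frob_inner_zero_left subsetD)
  qed
  have spanN: "span ?B = N"
  proof
    show "span ?B \<subseteq> N" by (rule span_is_subset[OF sub subm])
    show "N \<subseteq> span ?B"
    proof
      fix W assume W: "W \<in> N"
      define L where "L = lincomb (\<lambda>U. frob_inner U W) ?B"
      have Lspan: "L \<in> span ?B" unfolding L_def span_def using finB by auto
      have LN: "L \<in> N" using Lspan \<open>span ?B \<subseteq> N\<close> by auto
      have WL: "W \<in> carrier_mat n q" "L \<in> carrier_mat n q" using W LN NC by auto
      have dec: "W + (-1) \<cdot>\<^sub>m L = W - L" using WL by (intro eq_matI) auto
      have "W + (-1) \<cdot>\<^sub>m L \<in> N"
        using submodule.m_closed[OF subm W submodule.smult_closed[OF subm _ LN, of "-1"]]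
        by (simp add: module_mat_simps)
      then have mem: "W - L \<in> N" by (simp add: dec)
      have "W - L = 0\<^sub>m n q"
      proof (rule complete[OF mem])
        fix a assume a: "a \<in> I"
        then have fa: "f a \<in> carrier_mat n q" using C by auto
        have "frob_inner (f a) (W - L) = frob_inner W (f a) - frob_inner L (f a)"
          using fa WL by (metis frob_inner_commute frob_inner_minus_left minus_carrier_mat)
        also have "\<dots> = 0" using coeff[of "f a"] a fa WL(1) unfolding L_def
          by (simp add: frob_inner_commute[of W n q])
        finally show "frob_inner (f a) (W - L) = 0" .
      qed
      then have "W $$ (i, j) - L $$ (i, j) = 0" if "i < n" "j < q" for i j
        using WL that by (metis index_minus_mat(1) index_zero_mat(1) carrier_matD)
      then have "W = L" using WL by (intro eq_matI) auto
      then show "W \<in> span ?B" using Lspan by simp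
    qed
  qed
  \<comment> \<open>Independence and span were computed in the space of all matrices;
    \<open>span_li_not_depend\<close> transfers both to the space with carrier
    \<open>N\<close>.\<close>
  have "vsN.basis ?B"
    unfolding vsN.basis_def
    using li spanN sub span_li_not_depend[OF sub subm] by (simp add: module_mat_simps)
  then show ?thesis unfolding is_orthonormal_basis_def using N orthB by auto
qed

section \<open>Normal spaces and trigonometric curves\<close>

lemma subspace_normal_space: "subspace class_ring (normal_space n q M X) (module_mat TYPE(real) n q)"
proof -
  interpret matrix_vs n q "TYPE(real)" .
  have "Z \<in> carrier_mat n q" if "Z \<in> tangent_space n q M X" for Z
    using that unfolding tangent_space_def by auto
  then have "submodule class_ring (normal_space n q M X) (module_mat TYPE(real) n q)"
    unfolding normal_space_def
    by unfold_locales (auto simp: module_mat_simps frob_inner_zero_left frob_inner_add_left[of _ n q]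
        frob_inner_smult_left[of _ n q])
  then show ?thesis unfolding subspace_def using matrix_vs by auto
qed

text \<open>Each differentiation advances the phase of sine and cosine by \<open>pi / 2\<close>, so
  all derivatives have one closed form in \<open>k\<close>; the constant \<open>a\<close> survives
  only at \<open>k = 0\<close>.\<close>

lemma smooth_on_reals_trig:
  "smooth_on_reals S (\<lambda>t. a + b * cos t + c * sin t)"
proof -
  define D where "D k t = (if k = 0 then a else 0) + b * cos (t + real k * (pi / 2))
    + c * sin (t + real k * (pi / 2))" for k t
  have shift: "t + real (Suc k) * (pi / 2) = (t + real k * (pi / 2)) + pi / 2" for t k
    by (simp add: algebra_simps)
  have "(D k has_real_derivative D (Suc k) t) (at t)" for k t
    unfolding D_def shift cos_add sin_add by (auto intro!: derivative_eq_intros)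
  moreover have "D 0 = (\<lambda>t. a + b * cos t + c * sin t)" by (auto simp: D_def)
  ultimately show ?thesis unfolding smooth_on_reals_def by blast
qed

text \<open>Both kinds of curves used for completeness have this shape. The factor
  \<open>cos t - 1\<close> vanishes to first order at 0, so only \<open>Z\<close> contributes to the
  velocity. As the curve stays in \<open>M\<close> for all \<open>t\<close>, any radius serves; 1 is
  taken.\<close>

lemma tangent_spaceI_trig:
  assumes X: "X \<in> carrier_mat n q" and C: "C \<in> carrier_mat n q" and Z: "Z \<in> carrier_mat n q"
    and M: "\<And>t. X + ((cos t - 1) \<cdot>\<^sub>m C + sin t \<cdot>\<^sub>m Z) \<in> M"
  shows "Z \<in> tangent_space n q M X"
proof -
  define g where "g t = X + ((cos t - 1) \<cdot>\<^sub>m C + sin t \<cdot>\<^sub>m Z)" for t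
  have g0: "g 0 = X" using X C Z unfolding g_def by (intro eq_matI) auto
  have entry: "(\<lambda>t. g t $$ (i, j))
      = (\<lambda>t. (X $$ (i, j) - C $$ (i, j)) + C $$ (i, j) * cos t + Z $$ (i, j) * sin t)"
    if "i < n" "j < q" for i j
    using X C Z that unfolding g_def by (auto simp: algebra_simps)
  have "smooth_on_reals {-1<..<1} (\<lambda>t. g t $$ (i, j))"
    "((\<lambda>t. g t $$ (i, j)) has_real_derivative Z $$ (i, j)) (at 0)" if "i < n" "j < q" for i j
    unfolding entry[OF that]
    by (rule smooth_on_reals_trig) (auto intro!: derivative_eq_intros)
  then show ?thesis
    unfolding tangent_space_def using Z g0 M[folded g_def]
    by (intro CollectI conjI exI[of _ g] exI[of _ 1]) auto
qed

section \<open>Membership in \<open>Fv\<close> and explicit motions inside it\<close>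

lemma Fv_iff:
  "Y \<in> Fv n q v \<longleftrightarrow> Y \<in> carrier_mat n q \<and> Y\<^sup>T * Y = 1\<^sub>m q \<and> (\<exists>a\<in>carrier_vec q. Y *\<^sub>v a = v)"
proof -
  have "Y *\<^sub>v a \<in> carrier_vec n" if "Y \<in> carrier_mat n q" for a
    using that by (intro carrier_vecI) auto
  then show ?thesis
    unfolding Fv_def using vec_space.col_space_eq[of Y n q] by auto
qed

text \<open>Scaling the coefficient vector gives one inclusion for every factor; applied with
  \<open>1 / c\<close> it gives the converse. This permits passing to the normalised vector.\<close>

lemma Fv_smult:
  assumes "c \<noteq> 0"
  shows "Fv n q (c \<cdot>\<^sub>v v) = Fv n q v"
proof -
  have sub: "Fv n q v \<subseteq> Fv n q (c \<cdot>\<^sub>v v)" for c :: real and v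
    unfolding Fv_iff subset_iff by (metis mult_mat_vec smult_carrier_vec)
  have "(1 / c) \<cdot>\<^sub>v (c \<cdot>\<^sub>v v) = v" using assms by (intro eq_vecI) auto
  then show ?thesis using sub[of v c] sub[of "c \<cdot>\<^sub>v v" "1 / c"] by auto
qed

lemma gram_index:
  "Y \<in> carrier_mat n q \<Longrightarrow> k < q \<Longrightarrow> l < q \<Longrightarrow> (Y\<^sup>T * Y) $$ (k, l) = col Y k \<bullet> col Y l"
  by auto


text \<open>The new Gram matrix expands to \<open>I + (2 c + d . d) y y^T\<close>, and the condition
  on \<open>d . d\<close> cancels the correction.\<close>

lemma rank_one_update_orthonormal:
  assumes Y: "Y \<in> carrier_mat n q" "Y\<^sup>T * Y = 1\<^sub>m q"
    and d: "d \<in> carrier_vec n" "Y\<^sup>T *\<^sub>v d = c \<cdot>\<^sub>v y" "d \<bullet> d = - 2 * c"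
    and y: "y \<in> carrier_vec q"
  shows "(Y + outer_prod d y)\<^sup>T * (Y + outer_prod d y) = 1\<^sub>m q"
proof (rule eq_matI)
  fix k l assume "k < dim_row (1\<^sub>m q)" "l < dim_col (1\<^sub>m q)"
  then have kl: "k < q" "l < q" by auto
  have colG: "col (Y + outer_prod d y) j = col Y j + (y $ j) \<cdot>\<^sub>v d" if "j < q" for j
    using that Y d y by (intro eq_vecI) (auto simp del: col_add)
  have yd: "col Y j \<bullet> d = c * y $ j" if "j < q" for j
  proof -
    have "(Y\<^sup>T *\<^sub>v d) $ j = (c \<cdot>\<^sub>v y) $ j" using d by simp
    then show ?thesis using that Y y by simp
  qed
  have dy: "d \<bullet> col Y j = c * y $ j" if "j < q" for j
    using yd[OF that] d(1) Y that by (metis comm_scalar_prod col_carrier_vec carrier_matD(2))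
  have "((Y + outer_prod d y)\<^sup>T * (Y + outer_prod d y)) $$ (k, l)
      = col (Y + outer_prod d y) k \<bullet> col (Y + outer_prod d y) l"
    using kl Y d y by (intro gram_index[of _ n q]) auto
  also have "\<dots> = (col Y k + (y $ k) \<cdot>\<^sub>v d) \<bullet> (col Y l + (y $ l) \<cdot>\<^sub>v d)"
    using kl by (simp add: colG)
  also have "\<dots> = col Y k \<bullet> col Y l + y $ l * (c * y $ k) + y $ k * (c * y $ l)
      + y $ k * (y $ l * (- 2 * c))"
    using kl Y d y by (simp add: add_scalar_prod_distrib[of _ n] scalar_prod_add_distrib[of _ n]
        smult_scalar_prod_distrib[of _ n] scalar_prod_smult_distrib[of _ n] yd dy)
  also have "\<dots> = 1\<^sub>m q $$ (k, l)"
    using kl Y gram_index[of Y n q k l] by (simp add: algebra_simps)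
  finally show "((Y + outer_prod d y)\<^sup>T * (Y + outer_prod d y)) $$ (k, l) = 1\<^sub>m q $$ (k, l)" .
qed (use y in auto)

text \<open>Columns \<open>i\<close> and \<open>j\<close> become \<open>c x - s y\<close> and
  \<open>s x + c y\<close>, a plane rotation, which keeps the columns orthonormal and their span
  unchanged. It is written as \<open>X\<close> plus a correction to fit
  \<open>tangent_spaceI_trig\<close>.\<close>

lemma column_rotation_in_Fv:
  assumes X: "X \<in> Fv n q v" and ij: "i < q" "j < q" "i \<noteq> j" and cs: "c\<^sup>2 + s\<^sup>2 = 1"
  shows "X + ((c - 1) \<cdot>\<^sub>m (outer_prod (col X i) (unit_vec q i) + outer_prod (col X j) (unit_vec q j))
    + s \<cdot>\<^sub>m (outer_prod (col X i) (unit_vec q j) - outer_prod (col X j) (unit_vec q i))) \<in> Fv n q v"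
    (is "?Y \<in> _")
proof -
  obtain a where Xc: "X \<in> carrier_mat n q" and XtX: "X\<^sup>T * X = 1\<^sub>m q"
    and a: "a \<in> carrier_vec q" "X *\<^sub>v a = v"
    using X unfolding Fv_iff by auto
  let ?x = "col X i" and ?y = "col X j"
  have xy: "?x \<in> carrier_vec n" "?y \<in> carrier_vec n" using Xc by auto
  have Yc: "?Y \<in> carrier_mat n q" using Xc by (intro carrier_matI) auto
  have colY: "col ?Y l = (if l = i then c \<cdot>\<^sub>v ?x + (- s) \<cdot>\<^sub>v ?y
      else if l = j then s \<cdot>\<^sub>v ?x + c \<cdot>\<^sub>v ?y else col X l)" if "l < q" for l
    using Xc ij that by (intro eq_vecI) (auto simp: algebra_simps simp del: col_add)
  have gram: "col X k \<bullet> col X l = (if k = l then 1 else 0)" if "k < q" "l < q" for k l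
    using gram_index[OF Xc that] XtX that by simp
  have cs': "c * c + s * s = 1" using cs by (simp add: power2_eq_square)
  have YtY: "?Y\<^sup>T * ?Y = 1\<^sub>m q"
  proof (rule eq_matI)
    fix k l assume "k < dim_row (1\<^sub>m q)" "l < dim_col (1\<^sub>m q)"
    then have kl: "k < q" "l < q" by auto
    have "(?Y\<^sup>T * ?Y) $$ (k, l) = col ?Y k \<bullet> col ?Y l"
      using kl Yc by (rule_tac gram_index[of _ n q])
    also have "\<dots> = 1\<^sub>m q $$ (k, l)"
      unfolding colY[OF kl(1)] colY[OF kl(2)]
      using kl ij Xc xy cs' by (auto simp add: add_scalar_prod_distrib[of _ n]
          scalar_prod_add_distrib[of _ n] smult_scalar_prod_distrib[of _ n]
          scalar_prod_smult_distrib[of _ n] gram add.commute)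
    finally show "(?Y\<^sup>T * ?Y) $$ (k, l) = 1\<^sub>m q $$ (k, l)" .
  qed (use Yc in auto)
  \<comment> \<open>The amounts by which the transposed rotation changes the entries
    \<open>i\<close> and \<open>j\<close> of \<open>a\<close>.\<close>
  define \<alpha> where "\<alpha> = (c - 1) * a $ i - s * a $ j"
  define \<beta> where "\<beta> = s * a $ i + (c - 1) * a $ j"
  txt \<open>If the rotation is \<open>X R\<close>, then \<open>X a = (X R) b\<close> with \<open>b = R\<^sup>T a\<close>.\<close>
  define b where "b = a + (\<alpha> \<cdot>\<^sub>v unit_vec q i + \<beta> \<cdot>\<^sub>v unit_vec q j)"
  have b: "b \<in> carrier_vec q" using a unfolding b_def by auto
  have bi: "unit_vec q i \<bullet> b = c * a $ i - s * a $ j"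
    and bj: "unit_vec q j \<bullet> b = s * a $ i + c * a $ j"
    using ij a unfolding scalar_prod_left_unit[OF b ij(1)] scalar_prod_left_unit[OF b ij(2)]
    by (auto simp: b_def \<alpha>_def \<beta>_def algebra_simps)
  have Xb: "X *\<^sub>v b = v + (\<alpha> \<cdot>\<^sub>v ?x + \<beta> \<cdot>\<^sub>v ?y)"
    using Xc a ij unfolding b_def
    by (simp add: mult_add_distrib_mat_vec[of _ n q] mult_mat_vec[of _ n q] mult_unit_vec[of _ n q])
  have vdim: "dim_vec v = n" using a Xc by auto
  have "?Y *\<^sub>v b = X *\<^sub>v b + ((c - 1) \<cdot>\<^sub>v ((unit_vec q i \<bullet> b) \<cdot>\<^sub>v ?x + (unit_vec q j \<bullet> b) \<cdot>\<^sub>v ?y)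
      + s \<cdot>\<^sub>v ((unit_vec q j \<bullet> b) \<cdot>\<^sub>v ?x - (unit_vec q i \<bullet> b) \<cdot>\<^sub>v ?y))"
    using Xc b xy by (simp add: add_mult_distrib_mat_vec[of _ n q] smult_mat_mult_vec[of _ n q]
        minus_mult_distrib_mat_vec[of _ n q] outer_prod_mult_vec[of _ n _ q] minus_carrier_mat)
  also have "\<dots> = v"
  proof (rule eq_vecI)
    fix r assume r: "r < dim_vec v"
    \<comment> \<open>The total coefficients of \<open>x\<close> and \<open>y\<close> added to
      \<open>v\<close> are multiples of \<open>c^2 + s^2 - 1\<close>, hence zero.\<close>
    have "\<alpha> + ((c - 1) * (c * a $ i - s * a $ j) + s * (s * a $ i + c * a $ j)) = (c * c + s * s - 1) * a $ i"
      "\<beta> + ((c - 1) * (s * a $ i + c * a $ j) - s * (c * a $ i - s * a $ j)) = (c * c + s * s - 1) * a $ j"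
      by (simp_all add: \<alpha>_def \<beta>_def algebra_simps)
    then have "(\<alpha> + ((c - 1) * (c * a $ i - s * a $ j) + s * (s * a $ i + c * a $ j))) * ?x $ r = 0"
      "(\<beta> + ((c - 1) * (s * a $ i + c * a $ j) - s * (c * a $ i - s * a $ j))) * ?y $ r = 0"
      using cs' by simp_all
    then show "(X *\<^sub>v b + ((c - 1) \<cdot>\<^sub>v ((unit_vec q i \<bullet> b) \<cdot>\<^sub>v ?x + (unit_vec q j \<bullet> b) \<cdot>\<^sub>v ?y)
      + s \<cdot>\<^sub>v ((unit_vec q j \<bullet> b) \<cdot>\<^sub>v ?x - (unit_vec q i \<bullet> b) \<cdot>\<^sub>v ?y))) $ r = v $ r"
      using r Xc vdim unfolding Xb bi bj by (simp add: algebra_simps)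
  qed (use Xc Xb vdim in auto)
  finally have "?Y *\<^sub>v b = v" .
  then show ?thesis unfolding Fv_iff using Yc YtY b by blast
qed

text \<open>Here \<open>v\<close> stands for the normalised vector of the theorem; \<open>ww\<close> makes it a unit vector.\<close>

locale orthonormal_frame =
  fixes n q p :: nat and X Xp :: "real mat" and v w :: "real vec"
  assumes X: "X \<in> carrier_mat n q" and Xp: "Xp \<in> carrier_mat n p"
    and XtX: "X\<^sup>T * X = 1\<^sub>m q" and XptX: "Xp\<^sup>T * X = 0\<^sub>m p q" and XptXp: "Xp\<^sup>T * Xp = 1\<^sub>m p"
    and frame_complete: "\<And>M. M \<in> carrier_mat n q \<Longrightarrow> X\<^sup>T * M = 0\<^sub>m q q \<Longrightarrow> Xp\<^sup>T * M = 0\<^sub>m p q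
      \<Longrightarrow> M = 0\<^sub>m n q"
    and w: "w \<in> carrier_vec q" and ww: "w \<bullet> w = 1" and Xw: "X *\<^sub>v w = v"
begin

section \<open>The candidate basis and its inner products\<close>

text \<open>The sum type joins the three families into one indexed family. The diagonal needs its
  own case: the other formula would have norm \<open>sqrt 2\<close> at \<open>i = j\<close>.\<close>

definition normal_basis :: "nat \<times> nat + nat \<Rightarrow> real mat" where
  "normal_basis = case_sum
    (\<lambda>(i, j). if i = j then X * outer_prod (unit_vec q i) (unit_vec q i)
      else (1 / sqrt 2) \<cdot>\<^sub>m (X * (outer_prod (unit_vec q i) (unit_vec q j) + outer_prod (unit_vec q j) (unit_vec q i))))
    (\<lambda>k. Xp * outer_prod (unit_vec p k) v * X)"

lemma normal_basis_Inl:
  "normal_basis (Inl (i, j)) = (if i = j then X * outer_prod (unit_vec q i) (unit_vec q i)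
      else (1 / sqrt 2) \<cdot>\<^sub>m (X * (outer_prod (unit_vec q i) (unit_vec q j) + outer_prod (unit_vec q j) (unit_vec q i))))"
  by (simp add: normal_basis_def)

lemma v: "v \<in> carrier_vec n"
  unfolding Xw[symmetric] using X by (intro carrier_vecI) auto

lemma Xtv: "X\<^sup>T *\<^sub>v v = w"
  using X w assoc_mult_mat_vec[of "X\<^sup>T" q n X q w] unfolding Xw[symmetric] by (simp add: XtX)

lemma XtXp: "X\<^sup>T * Xp = 0\<^sub>m q p"
proof -
  have "X\<^sup>T * Xp = (Xp\<^sup>T * X)\<^sup>T" using X Xp by (subst transpose_mult[of _ p n _ q]) auto
  then show ?thesis by (simp add: XptX)
qed

text \<open>Since \<open>v^T X = (X^T v)^T = w^T\<close>, the unit vector \<open>w\<close> replaces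
  \<open>v\<close>, and these elements have the form \<open>Xp S\<close>.\<close>

lemma normal_basis_Inr: "normal_basis (Inr k) = Xp * outer_prod (unit_vec p k) w"
proof -
  have "normal_basis (Inr k) = Xp * (outer_prod (unit_vec p k) v * X)"
    using X Xp v by (auto simp: normal_basis_def intro!: assoc_mult_mat[of _ n p _ n _ q])
  then show ?thesis using X v by (simp add: outer_prod_mult[of _ p _ n _ q] Xtv)
qed

lemma normal_basis_carrier: "normal_basis a \<in> carrier_mat n q"
proof (cases a)
  case (Inl ij)
  then show ?thesis using X
    by (cases ij) (auto simp: normal_basis_Inl intro!: mult_carrier_mat[of _ n q])
next
  case (Inr k)
  then show ?thesis using Xp w
    by (auto simp: normal_basis_Inr intro!: mult_carrier_mat[of _ n p])
qed

lemma frob_inner_normal_basis_Inl: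
  assumes "i < q" "j < q" "M \<in> carrier_mat n q"
  shows "frob_inner (normal_basis (Inl (i, j))) M = (if i = j then (X\<^sup>T * M) $$ (i, i)
    else ((X\<^sup>T * M) $$ (i, j) + (X\<^sup>T * M) $$ (j, i)) / sqrt 2)"
proof -
  have A: "X\<^sup>T * M \<in> carrier_mat q q" using X assms by auto
  have e: "frob_inner (outer_prod (unit_vec q i) (unit_vec q j)) (X\<^sup>T * M) = (X\<^sup>T * M) $$ (i, j)"
    if "i < q" "j < q" for i j
    using that A X assms by (simp add: frob_inner_outer_prod[of _ q _ q] mult_unit_vec[of _ q q] scalar_prod_left_unit[of _ q])
  show ?thesis
    using X A assms
    by (simp add: normal_basis_Inl frob_inner_smult_left[of _ n q] frob_inner_mult_left[of _ n q _ q]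
        frob_inner_add_left[of _ q q] e mult_carrier_mat[of _ n q])
qed

lemma frob_inner_normal_basis_Inr:
  assumes "k < p" "M \<in> carrier_mat n q"
  shows "frob_inner (normal_basis (Inr k)) M = ((Xp\<^sup>T * M) *\<^sub>v w) $ k"
proof -
  have A: "Xp\<^sup>T * M \<in> carrier_mat p q" using Xp assms by auto
  then have Aw: "(Xp\<^sup>T * M) *\<^sub>v w \<in> carrier_vec p" using w by auto
  have "frob_inner (normal_basis (Inr k)) M = frob_inner (outer_prod (unit_vec p k) w) (Xp\<^sup>T * M)"
    unfolding normal_basis_Inr using Xp w assms by (intro frob_inner_mult_left[of _ n p _ q]) auto
  also have "\<dots> = unit_vec p k \<bullet> ((Xp\<^sup>T * M) *\<^sub>v w)"
    using A w by (intro frob_inner_outer_prod) auto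
  also have "\<dots> = ((Xp\<^sup>T * M) *\<^sub>v w) $ k"
    by (rule scalar_prod_left_unit[OF Aw assms(1)])
  finally show ?thesis .
qed

lemma Xt_normal_basis_Inl:
  "X\<^sup>T * normal_basis (Inl (i, j)) = (if i = j then outer_prod (unit_vec q i) (unit_vec q i)
    else (1 / sqrt 2) \<cdot>\<^sub>m (outer_prod (unit_vec q i) (unit_vec q j) + outer_prod (unit_vec q j) (unit_vec q i)))"
  and Xpt_normal_basis_Inl: "Xp\<^sup>T * normal_basis (Inl (i, j)) = 0\<^sub>m p q"
proof -
  have "X\<^sup>T * (X * S) = S" "Xp\<^sup>T * (X * S) = 0\<^sub>m p q" "X * S \<in> carrier_mat n q"
    if "S \<in> carrier_mat q q" for S
    using that X Xp assoc_mult_mat[of "X\<^sup>T" q n X q S q] assoc_mult_mat[of "Xp\<^sup>T" p n X q S q]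
    by (auto simp: XtX XptX)
  then show "X\<^sup>T * normal_basis (Inl (i, j)) = (if i = j then outer_prod (unit_vec q i) (unit_vec q i)
    else (1 / sqrt 2) \<cdot>\<^sub>m (outer_prod (unit_vec q i) (unit_vec q j) + outer_prod (unit_vec q j) (unit_vec q i)))"
    "Xp\<^sup>T * normal_basis (Inl (i, j)) = 0\<^sub>m p q"
    using X Xp by (auto simp: normal_basis_Inl mult_smult_distrib[of _ _ n _ q])
qed

lemma Xt_normal_basis_Inr: "X\<^sup>T * normal_basis (Inr k) = 0\<^sub>m q q"
  and Xpt_normal_basis_Inr: "Xp\<^sup>T * normal_basis (Inr k) = outer_prod (unit_vec p k) w"
proof -
  have S: "outer_prod (unit_vec p k) w \<in> carrier_mat p q" using w by simp
  show "X\<^sup>T * normal_basis (Inr k) = 0\<^sub>m q q"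
    using S X Xp assoc_mult_mat[of "X\<^sup>T" q n Xp p _ q] unfolding normal_basis_Inr
    by (metis XtXp left_mult_zero_mat transpose_carrier_mat)
  show "Xp\<^sup>T * normal_basis (Inr k) = outer_prod (unit_vec p k) w"
    using S Xp assoc_mult_mat[of "Xp\<^sup>T" p n Xp p _ q] unfolding normal_basis_Inr
    by (metis XptXp left_mult_one_mat transpose_carrier_mat)
qed

definition normal_index :: "(nat \<times> nat + nat) set" where
  "normal_index = Inl ` {(i, j). i \<le> j \<and> j < q} \<union> Inr ` {..<p}"

text \<open>Pairing with an \<open>Inl\<close> member sees only the \<open>X^T\<close> block, with
  an \<open>Inr\<close> member only the \<open>Xp^T\<close> block, so mixed pairs vanish. Within
  \<open>Inl\<close>, the order \<open>i \<le> j\<close> lists each symmetric matrix once; within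
  \<open>Inr\<close>, the norm is 1 by \<open>ww\<close>.\<close>

lemma normal_basis_orthonormal:
  assumes "a \<in> normal_index" "b \<in> normal_index"
  shows "frob_inner (normal_basis a) (normal_basis b) = (if a = b then 1 else 0)"
proof -
  consider (inl) i j where "a = Inl (i, j)" "i \<le> j" "j < q" | (inr) k where "a = Inr k" "k < p"
    using assms(1) by (auto simp: normal_index_def)
  then show ?thesis
  proof cases
    case inl
    show ?thesis
    proof (cases b)
      case (Inl kl)
      then obtain k l where kl: "b = Inl (k, l)" "k \<le> l" "l < q"
        using assms(2) by (auto simp: normal_index_def)
      show ?thesis
        using inl kl normal_basis_carrier by (auto simp: frob_inner_normal_basis_Inl Xt_normal_basis_Inl)
    next
      case (Inr k)
      then show ?thesis
        using inl normal_basis_carrier by (auto simp: frob_inner_normal_basis_Inl Xt_normal_basis_Inr)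
    qed
  next
    case inr
    show ?thesis
    proof (cases b)
      case (Inl kl)
      then show ?thesis using inr normal_basis_carrier w
        by (cases kl) (auto simp: frob_inner_normal_basis_Inr Xpt_normal_basis_Inl)
    next
      case (Inr l)
      then have "l < p" using assms(2) by (auto simp: normal_index_def)
      then show ?thesis using inr Inr normal_basis_carrier w
        by (auto simp: frob_inner_normal_basis_Inr Xpt_normal_basis_Inr outer_prod_mult_vec[of _ p _ q] ww)
    qed
  qed
qed

section \<open>Linear conditions on tangent vectors\<close>

lemma tangent_space_gram:
  assumes "Z \<in> tangent_space n q (Fv n q v) X" "i < q" "j < q"
  shows "(X\<^sup>T * Z) $$ (i, j) + (X\<^sup>T * Z) $$ (j, i) = 0"
proof -
  obtain g e where Z: "Z \<in> carrier_mat n q" and e: "e > 0" and g0: "g 0 = X"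
    and g: "\<And>t. t \<in> {-e<..<e} \<Longrightarrow> g t \<in> Fv n q v"
    and dg: "\<And>i j. i < n \<Longrightarrow> j < q \<Longrightarrow> ((\<lambda>t. g t $$ (i, j)) has_real_derivative Z $$ (i, j)) (at 0)"
    using assms(1) unfolding tangent_space_def by blast
  let ?h = "\<lambda>t. \<Sum>r<n. g t $$ (r, i) * g t $$ (r, j)"
  have d1: "(?h has_real_derivative (\<Sum>r<n. Z $$ (r, i) * g 0 $$ (r, j) + Z $$ (r, j) * g 0 $$ (r, i))) (at 0)"
    using assms by (intro DERIV_sum DERIV_mult dg) auto
  \<comment> \<open>Along the curve this Gram entry is constant near 0; uniqueness of the derivative
    then gives the identity.\<close>
  have d2: "(?h has_real_derivative 0) (at 0)"
  proof (rule has_field_derivative_transform_within_open[of "\<lambda>_. 1\<^sub>m q $$ (i, j)" _ _ "{-e<..<e}"])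
    fix t assume "t \<in> {-e<..<e}"
    then have "g t \<in> carrier_mat n q" "(g t)\<^sup>T * g t = 1\<^sub>m q" using g by (auto simp: Fv_iff)
    then show "1\<^sub>m q $$ (i, j) = ?h t"
      using assms gram_index[of "g t" n q i j] by (simp add: scalar_prod_def lessThan_atLeast0)
  qed (use e in auto)
  have "(\<Sum>r<n. Z $$ (r, i) * X $$ (r, j) + Z $$ (r, j) * X $$ (r, i)) = 0"
    using DERIV_unique[OF d1 d2] unfolding g0 .
  then show ?thesis
    using X Z assms by (simp add: scalar_prod_def lessThan_atLeast0 sum.distrib mult.commute add.commute)
qed

text \<open>Differentiating \<open>Y Y^T v = v\<close> at \<open>X\<close> gives
  \<open>Z w + X Z^T v = 0\<close>, and \<open>Xp^T\<close> annihilates the second term.\<close>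

lemma tangent_space_kernel:
  assumes "Z \<in> tangent_space n q (Fv n q v) X"
  shows "(Xp\<^sup>T * Z) *\<^sub>v w = 0\<^sub>v p"
proof -
  obtain g e where Z: "Z \<in> carrier_mat n q" and e: "e > 0" and g0: "g 0 = X"
    and g: "\<And>t. t \<in> {-e<..<e} \<Longrightarrow> g t \<in> Fv n q v"
    and dg: "\<And>i j. i < n \<Longrightarrow> j < q \<Longrightarrow> ((\<lambda>t. g t $$ (i, j)) has_real_derivative Z $$ (i, j)) (at 0)"
    using assms(1) unfolding tangent_space_def by blast
  have "(Z *\<^sub>v w + X *\<^sub>v (Z\<^sup>T *\<^sub>v v)) $ r = 0" if r: "r < n" for r
  proof -
    let ?h = "\<lambda>t. \<Sum>j<q. g t $$ (r, j) * (\<Sum>i<n. g t $$ (i, j) * v $ i)"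
    have d1: "(?h has_real_derivative (\<Sum>j<q. Z $$ (r, j) * (\<Sum>i<n. g 0 $$ (i, j) * v $ i)
        + (\<Sum>i<n. Z $$ (i, j) * v $ i) * g 0 $$ (r, j))) (at 0)"
      using r by (intro DERIV_sum DERIV_mult DERIV_cmult_right dg) auto
    have d2: "(?h has_real_derivative 0) (at 0)"
    proof (rule has_field_derivative_transform_within_open[of "\<lambda>_. v $ r" _ _ "{-e<..<e}"])
      fix t assume "t \<in> {-e<..<e}"
      then obtain a where gt: "g t \<in> carrier_mat n q" "(g t)\<^sup>T * g t = 1\<^sub>m q"
        and a: "a \<in> carrier_vec q" "g t *\<^sub>v a = v" using g by (auto simp: Fv_iff)
      \<comment> \<open>The vector \<open>a\<close> depends on \<open>t\<close> without any known
        regularity. The expression \<open>(g t)^T v\<close> recovers it and is linear in the entries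
        of \<open>g t\<close>, hence differentiable at 0.\<close>
      have "(g t)\<^sup>T *\<^sub>v v = a"
        using gt a assoc_mult_mat_vec[of "(g t)\<^sup>T" q n "g t" q a] by simp
      then have "v $ r = (g t *\<^sub>v ((g t)\<^sup>T *\<^sub>v v)) $ r" using a by simp
      also have "\<dots> = ?h t"
        using gt r v by (simp add: scalar_prod_def lessThan_atLeast0)
      finally show "v $ r = ?h t" .
    qed (use e in auto)
    have "(\<Sum>j<q. Z $$ (r, j) * (\<Sum>i<n. X $$ (i, j) * v $ i)
        + (\<Sum>i<n. Z $$ (i, j) * v $ i) * X $$ (r, j)) = 0"
      using DERIV_unique[OF d1 d2] unfolding g0 .
    moreover have "(\<Sum>i<n. X $$ (i, j) * v $ i) = w $ j" if "j < q" for j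
      using that X v by (simp add: Xtv[symmetric] scalar_prod_def lessThan_atLeast0)
    ultimately show ?thesis
      using r X Z v w by (simp add: scalar_prod_def lessThan_atLeast0 sum.distrib mult.commute)
  qed
  then have "Z *\<^sub>v w + X *\<^sub>v (Z\<^sup>T *\<^sub>v v) = 0\<^sub>v n"
    using X Z by (intro eq_vecI) auto
  then have "Xp\<^sup>T *\<^sub>v (Z *\<^sub>v w + X *\<^sub>v (Z\<^sup>T *\<^sub>v v)) = 0\<^sub>v p"
    using Xp by (intro eq_vecI) auto
  moreover have "Xp\<^sup>T *\<^sub>v (X *\<^sub>v (Z\<^sup>T *\<^sub>v v)) = 0\<^sub>v p"
  proof -
    have x: "Z\<^sup>T *\<^sub>v v \<in> carrier_vec q" using Z v by auto
    then have "Xp\<^sup>T *\<^sub>v (X *\<^sub>v (Z\<^sup>T *\<^sub>v v)) = 0\<^sub>m p q *\<^sub>v (Z\<^sup>T *\<^sub>v v)"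
      using X Xp assoc_mult_mat_vec[of "Xp\<^sup>T" p n X q "Z\<^sup>T *\<^sub>v v"] by (simp add: XptX)
    also have "\<dots> = 0\<^sub>v p"
      using x by (intro eq_vecI) (simp_all add: scalar_prod_left_zero[OF x])
    finally show ?thesis .
  qed
  ultimately show ?thesis
    using X Xp Z v w by (simp add: mult_add_distrib_mat_vec[of _ p n])
qed

text \<open>The pairings of the family with \<open>Z\<close> are, up to scaling, the quantities that
  \<open>tangent_space_gram\<close> and \<open>tangent_space_kernel\<close> show to vanish.\<close>

lemma normal_basis_normal:
  assumes "a \<in> normal_index"
  shows "normal_basis a \<in> normal_space n q (Fv n q v) X"
  unfolding normal_space_def
proof (intro CollectI conjI ballI normal_basis_carrier)
  fix Z assume Z: "Z \<in> tangent_space n q (Fv n q v) X"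
  then have Zc: "Z \<in> carrier_mat n q" by (simp add: tangent_space_def)
  show "frob_inner (normal_basis a) Z = 0"
    using assms tangent_space_kernel[OF Z] tangent_space_gram[OF Z]
    by (force simp: normal_index_def frob_inner_normal_basis_Inl[OF _ _ Zc] frob_inner_normal_basis_Inr[OF _ Zc])
qed

section \<open>Completeness by testing normal vectors on explicit curves\<close>

lemma X_in_Fv: "X \<in> Fv n q v"
  unfolding Fv_iff using X XtX w Xw by auto

text \<open>Pairing \<open>W\<close> with the velocity of the rotation of columns \<open>i\<close>
  and \<open>j\<close> gives the difference of the two mirrored entries.\<close>

lemma normal_space_Xt_symmetric:
  assumes W: "W \<in> normal_space n q (Fv n q v) X" and ij: "i < q" "j < q"
  shows "(X\<^sup>T * W) $$ (i, j) = (X\<^sup>T * W) $$ (j, i)"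
proof (cases "i = j")
  case False
  let ?Z = "outer_prod (col X i) (unit_vec q j) - outer_prod (col X j) (unit_vec q i)"
  have Wc: "W \<in> carrier_mat n q" using W by (simp add: normal_space_def)
  have xy: "col X i \<in> carrier_vec n" "col X j \<in> carrier_vec n" using X by auto
  have Zc: "?Z \<in> carrier_mat n q" using xy by (intro minus_carrier_mat) simp
  have "?Z \<in> tangent_space n q (Fv n q v) X"
  proof (rule tangent_spaceI_trig[OF X _ Zc])
    show "outer_prod (col X i) (unit_vec q i) + outer_prod (col X j) (unit_vec q j) \<in> carrier_mat n q"
      using xy by simp
  qed (rule column_rotation_in_Fv[OF X_in_Fv ij False sin_cos_squared_add2])
  then have "frob_inner W ?Z = 0" using W by (simp add: normal_space_def)
  then have "frob_inner ?Z W = 0" using frob_inner_commute[OF Wc Zc] by simp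
  then show ?thesis
    using xy Wc X ij by (simp add: frob_inner_minus_left[of _ n q] frob_inner_outer_prod[of _ n _ q]
        mult_unit_vec[of _ n q])
qed simp

text \<open>The curve turns the unit vector \<open>X y\<close> towards \<open>z\<close> and leaves
  \<open>X u\<close> fixed for every \<open>u\<close> orthogonal to \<open>y\<close>. In particular
  \<open>w\<close> stays a coefficient vector of \<open>v\<close>. Its velocity \<open>z y^T\<close>
  pairs with \<open>W\<close> to \<open>z . W y\<close>, the required entry.\<close>

lemma normal_space_Xpt_orthogonal:
  assumes W: "W \<in> normal_space n q (Fv n q v) X" and k: "k < p"
    and y: "y \<in> carrier_vec q" "y \<bullet> y = 1" "y \<bullet> w = 0"
  shows "((Xp\<^sup>T * W) *\<^sub>v y) $ k = 0"
proof -
  let ?z = "col Xp k" and ?x = "X *\<^sub>v y"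
  have Wc: "W \<in> carrier_mat n q" using W by (simp add: normal_space_def)
  have z: "?z \<in> carrier_vec n" and x: "?x \<in> carrier_vec n" using X Xp y by auto
  have zz: "?z \<bullet> ?z = 1" using gram_index[OF Xp k k] k by (simp add: XptXp)
  have Xtz: "X\<^sup>T *\<^sub>v ?z = 0\<^sub>v q"
  proof (rule eq_vecI)
    fix i assume i: "i < dim_vec (0\<^sub>v q)"
    then have "(X\<^sup>T * Xp) $$ (i, k) = 0" using k by (simp add: XtXp)
    then show "(X\<^sup>T *\<^sub>v ?z) $ i = 0\<^sub>v q $ i" using X Xp i k by simp
  qed (use X in auto)
  have Xtx: "X\<^sup>T *\<^sub>v ?x = y"
    using assoc_mult_mat_vec[of "X\<^sup>T" q n X q y] X y by (simp add: XtX)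
  have xx: "?x \<bullet> ?x = 1" and zx: "?z \<bullet> ?x = 0"
    using transpose_vec_mult_scalar[OF X y(1) x] transpose_vec_mult_scalar[OF X y(1) z] Xtx Xtz y by auto
  have xz: "?x \<bullet> ?z = 0" using zx comm_scalar_prod[OF x z] by simp
  have Z: "outer_prod ?z y \<in> tangent_space n q (Fv n q v) X"
  proof (rule tangent_spaceI_trig[where C = "outer_prod ?x y"])
    fix t :: real
    define c s where "c = cos t - 1" and "s = sin t"
    \<comment> \<open>\<open>(cos t - 1)^2 + sin^2 t = 2 - 2 cos t\<close>; as \<open>X y\<close>
      and \<open>z\<close> are orthonormal, this is the value of \<open>d . d\<close> that the
      rank-one update requires.\<close>
    have cs: "c * c + s * s = - 2 * c"
      using sin_cos_squared_add[of t] by (simp add: c_def s_def power2_eq_square algebra_simps)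
    define d where "d = c \<cdot>\<^sub>v ?x + s \<cdot>\<^sub>v ?z"
    have d: "d \<in> carrier_vec n" using x z by (simp add: d_def)
    have eq: "c \<cdot>\<^sub>m outer_prod ?x y + s \<cdot>\<^sub>m outer_prod ?z y = outer_prod d y"
      using X Xp x z y by (intro eq_matI) (auto simp: d_def algebra_simps)
    have "X\<^sup>T *\<^sub>v d = c \<cdot>\<^sub>v y"
    proof -
      have "X\<^sup>T *\<^sub>v d = c \<cdot>\<^sub>v y + s \<cdot>\<^sub>v 0\<^sub>v q"
        using X x z y unfolding d_def
        by (simp add: mult_add_distrib_mat_vec[of _ q n] mult_mat_vec[of _ q n] Xtx Xtz)
      also have "\<dots> = c \<cdot>\<^sub>v y" using y by (intro eq_vecI) auto
      finally show ?thesis .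
    qed
    moreover have "d \<bullet> d = - 2 * c"
      using x z cs unfolding d_def by (simp add: add_scalar_prod_distrib[of _ n]
          scalar_prod_add_distrib[of _ n] smult_scalar_prod_distrib[of _ n]
          scalar_prod_smult_distrib[of _ n] xx zz xz zx)
    ultimately have "(X + outer_prod d y)\<^sup>T * (X + outer_prod d y) = 1\<^sub>m q"
      by (intro rank_one_update_orthonormal[OF X XtX d _ _ y(1)])
    moreover have "(X + outer_prod d y) *\<^sub>v w = v"
    proof -
      have "(X + outer_prod d y) *\<^sub>v w = v + 0 \<cdot>\<^sub>v d"
        using X d y w by (simp add: add_mult_distrib_mat_vec[of _ n q] outer_prod_mult_vec[of _ n _ q] Xw)
      also have "\<dots> = v" using d v by (intro eq_vecI) auto
      finally show ?thesis .
    qed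
    ultimately have "X + outer_prod d y \<in> Fv n q v"
      unfolding Fv_iff using X d y w by auto
    then show "X + ((cos t - 1) \<cdot>\<^sub>m outer_prod ?x y + sin t \<cdot>\<^sub>m outer_prod ?z y) \<in> Fv n q v"
      using eq unfolding c_def s_def by simp
  qed (use X x z y in auto)
  then have "frob_inner W (outer_prod ?z y) = 0" using W by (simp add: normal_space_def)
  then have "frob_inner (outer_prod ?z y) W = 0"
    using frob_inner_commute[OF Wc outer_prod_carrier[OF z y(1)]] by simp
  then have "?z \<bullet> (W *\<^sub>v y) = 0" using frob_inner_outer_prod[OF z y(1) Wc] by simp
  then show ?thesis
    using Xp Wc y k assoc_mult_mat_vec[of "Xp\<^sup>T" p n W q y] by simp
qed

lemma normal_basis_complete:
  assumes W: "W \<in> normal_space n q (Fv n q v) X"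
    and orth: "\<And>a. a \<in> normal_index \<Longrightarrow> frob_inner (normal_basis a) W = 0"
  shows "W = 0\<^sub>m n q"
proof (rule frame_complete)
  show Wc: "W \<in> carrier_mat n q" using W by (simp add: normal_space_def)
  \<comment> \<open>Off the diagonal the pairing only makes the sum of two mirrored entries vanish;
    symmetry makes each of them zero.\<close>
  have upper: "(X\<^sup>T * W) $$ (i, j) = 0" if "i \<le> j" "j < q" for i j
  proof -
    have "frob_inner (normal_basis (Inl (i, j))) W = 0"
      using that by (intro orth) (auto simp: normal_index_def)
    then show ?thesis
      using that normal_space_Xt_symmetric[OF W, of i j]
      by (auto simp: frob_inner_normal_basis_Inl[OF _ _ Wc] split: if_splits)
  qed
  show "X\<^sup>T * W = 0\<^sub>m q q"
  proof (rule eq_matI)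
    fix i j assume "i < dim_row (0\<^sub>m q q)" "j < dim_col (0\<^sub>m q q)"
    then show "(X\<^sup>T * W) $$ (i, j) = 0\<^sub>m q q $$ (i, j)"
      using upper[of i j] upper[of j i] normal_space_Xt_symmetric[OF W, of i j] by (cases "i \<le> j") auto
  qed (use X Wc in auto)
  have K: "Xp\<^sup>T * W \<in> carrier_mat p q" using Xp Wc by auto
  \<comment> \<open>A nonzero row \<open>b\<close> is orthogonal to \<open>w\<close>, so its own
    normalisation is an admissible \<open>y\<close>. Then \<open>b . y\<close> would be 0 and also
    the positive norm of \<open>b\<close>.\<close>
  have "row (Xp\<^sup>T * W) k = 0\<^sub>v q" if k: "k < p" for k
  proof (rule ccontr)
    let ?b = "row (Xp\<^sup>T * W) k"
    assume nz: "?b \<noteq> 0\<^sub>v q"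
    have b: "?b \<in> carrier_vec q" using K k by auto
    have Kx: "((Xp\<^sup>T * W) *\<^sub>v x) $ k = ?b \<bullet> x" for x using K k by auto
    have bw: "?b \<bullet> w = 0"
      using orth[of "Inr k"] k frob_inner_normal_basis_Inr[OF k Wc] Kx by (simp add: normal_index_def)
    have bb: "?b \<bullet> ?b > 0"
    proof -
      obtain j where j: "j < q" "?b $ j \<noteq> 0" using nz b by (metis eq_vecI carrier_vecD index_zero_vec)
      have "0 < (\<Sum>j\<in>{0..<q}. ?b $ j * ?b $ j)"
        using j by (intro sum_pos2[of _ j]) (auto simp: zero_less_mult_iff linorder_neq_iff)
      then show ?thesis unfolding scalar_prod_def carrier_vecD[OF b] .
    qed
    define y where "y = (1 / sqrt (?b \<bullet> ?b)) \<cdot>\<^sub>v ?b"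
    have "?b \<bullet> y = 0"
      unfolding Kx[symmetric]
      using b bb bw w by (intro normal_space_Xpt_orthogonal[OF W k]) (auto simp: y_def)
    then show False using b bb by (simp add: y_def)
  qed
  then show "Xp\<^sup>T * W = 0\<^sub>m p q"
    using K by (intro eq_rowI) auto
qed

lemma normal_basis_is_orthonormal_basis:
  "is_orthonormal_basis n q (normal_space n q (Fv n q v) X) (normal_basis ` normal_index)"
proof (rule is_orthonormal_basisI[OF subspace_normal_space])
  have "{(i, j). i \<le> j \<and> j < q} \<subseteq> {..<q} \<times> {..<q}" by auto
  then show "finite normal_index"
    unfolding normal_index_def by (auto intro: finite_subset)
qed (use normal_basis_normal normal_basis_orthonormal normal_basis_complete in auto)

end

section \<open>The orthogonal completion and the final assembly\<close>

text \<open>The block identities are Gram entries of \<open>H^T H = I\<close>. The last claim uses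
  \<open>H H^T = I\<close>: \<open>M = H (H^T M)\<close>, and the rows of \<open>H^T M\<close> are
  those of \<open>A^T M\<close> followed by those of \<open>B^T M\<close>.\<close>

lemma real_orthogonal_hconcatD:
  assumes A: "A \<in> carrier_mat n q" and B: "B \<in> carrier_mat n p"
    and orth: "real_orthogonal_mat (hconcat_mat A B)"
  shows "B\<^sup>T * A = 0\<^sub>m p q" and "B\<^sup>T * B = 1\<^sub>m p"
    and "M \<in> carrier_mat n m \<Longrightarrow> A\<^sup>T * M = 0\<^sub>m q m \<Longrightarrow> B\<^sup>T * M = 0\<^sub>m p m \<Longrightarrow> M = 0\<^sub>m n m"
proof -
  let ?H = "hconcat_mat A B"
  have dims: "dim_row ?H = n" "dim_col ?H = q + p" using A B by (auto simp: hconcat_mat_def)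
  then have n: "n = q + p" using orth by (simp add: real_orthogonal_mat_def)
  have H: "?H \<in> carrier_mat n n" using dims n by (intro carrier_matI) auto
  have HtH: "?H\<^sup>T * ?H = 1\<^sub>m n" and HHt: "?H * ?H\<^sup>T = 1\<^sub>m n"
    using orth dims n by (auto simp: real_orthogonal_mat_def inverts_mat_def)
  have colA: "col ?H i = col A i" if "i < q" for i
    using that A B unfolding hconcat_mat_def by (subst col_mat_of_cols) (auto simp: nth_append)
  have colB: "col ?H (q + i) = col B i" if "i < p" for i
    using that A B unfolding hconcat_mat_def by (subst col_mat_of_cols) (auto simp: nth_append)
  have gram: "col ?H k \<bullet> col ?H l = (if k = l then 1 else 0)" if "k < n" "l < n" for k l
    using gram_index[OF H that] HtH that by simp
  show "B\<^sup>T * A = 0\<^sub>m p q"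
  proof (rule eq_matI)
    fix i j assume "i < dim_row (0\<^sub>m p q)" "j < dim_col (0\<^sub>m p q)"
    then show "(B\<^sup>T * A) $$ (i, j) = 0\<^sub>m p q $$ (i, j)"
      using gram[of "q + i" j] colA[of j] colB[of i] A B n by auto
  qed (use A B in auto)
  show "B\<^sup>T * B = 1\<^sub>m p"
  proof (rule eq_matI)
    fix i j assume "i < dim_row (1\<^sub>m p)" "j < dim_col (1\<^sub>m p)"
    then show "(B\<^sup>T * B) $$ (i, j) = 1\<^sub>m p $$ (i, j)"
      using gram[of "q + i" "q + j"] colB[of j] colB[of i] A B n by auto
  qed (use A B in auto)
  assume M: "M \<in> carrier_mat n m" and AM: "A\<^sup>T * M = 0\<^sub>m q m" and BM: "B\<^sup>T * M = 0\<^sub>m p m"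
  have "?H\<^sup>T * M = 0\<^sub>m n m"
  proof (rule eq_matI)
    fix i j assume "i < dim_row (0\<^sub>m n m)" "j < dim_col (0\<^sub>m n m)"
    then have ij: "i < n" "j < m" by auto
    have *: "(?H\<^sup>T * M) $$ (i, j) = col ?H i \<bullet> col M j" using ij H M by simp
    show "(?H\<^sup>T * M) $$ (i, j) = 0\<^sub>m n m $$ (i, j)"
    proof (cases "i < q")
      case True
      then have "(A\<^sup>T * M) $$ (i, j) = 0" using AM ij by simp
      then show ?thesis using True ij A M unfolding * by (simp add: colA)
    next
      case False
      then have i: "i - q < p" "q + (i - q) = i" using ij n by auto
      then have "(B\<^sup>T * M) $$ (i - q, j) = 0" using BM ij by simp
      then show ?thesis using i ij B M colB[of "i - q"] unfolding * by simp
    qed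
  qed (use H M in auto)
  moreover have "M = ?H * (?H\<^sup>T * M)"
    using assoc_mult_mat[of ?H n n "?H\<^sup>T" n M m] H M HHt by simp
  ultimately show "M = 0\<^sub>m n m" using H by simp
qed

theorem lemma3p2:
  fixes n q :: nat and v vt :: "real vec" and X Xp :: "real mat"
  assumes "1 \<le> q" and "q \<le> n"
    and "v \<in> carrier_vec n" and "\<forall>i<n. v $ i > 0"
    and "X \<in> Fv n q v"
    and "Xp \<in> carrier_mat n (n - q)"
    and "real_orthogonal_mat (hconcat_mat X Xp)"
    and "vt = (1 / euclid_norm v) \<cdot>\<^sub>v v"
  shows "is_orthonormal_basis n q (normal_space n q (Fv n q v) X)
    ({X * outer_prod (unit_vec q i) (unit_vec q i) | i. i < q}
     \<union> {(1 / sqrt 2) \<cdot>\<^sub>m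
           (X * (outer_prod (unit_vec q i) (unit_vec q j) + outer_prod (unit_vec q j) (unit_vec q i)))
         | i j. i < j \<and> j < q}
     \<union> {Xp * outer_prod (unit_vec (n - q) i) vt * X | i. i < n - q})"
proof -
  \<comment> \<open>Positive entries and a nonempty index range make \<open>v\<close> nonzero, so it
    can be normalised.\<close>
  have "0 < (\<Sum>i\<in>{0..<n}. v $ i * v $ i)"
    using assms(1,2,4) by (intro sum_pos) auto
  then have vv: "v \<bullet> v > 0" using assms(3) by (simp add: scalar_prod_def)
  then have norm: "euclid_norm v > 0" "euclid_norm v * euclid_norm v = v \<bullet> v"
    by (simp_all add: euclid_norm_def)
  have Fv: "Fv n q vt = Fv n q v"
    unfolding assms(8) using norm by (intro Fv_smult) simp
  have vtvt: "vt \<bullet> vt = 1" using norm vv assms(3) unfolding assms(8) by (simp add: divide_simps)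
  obtain w where X: "X \<in> carrier_mat n q" and XtX: "X\<^sup>T * X = 1\<^sub>m q"
    and w: "w \<in> carrier_vec q" "X *\<^sub>v w = vt"
    using assms(5) unfolding Fv[symmetric] Fv_iff by auto
  have vt: "vt \<in> carrier_vec n" using assms(3,8) by simp
  have "X\<^sup>T *\<^sub>v vt = w"
    using assoc_mult_mat_vec[of "X\<^sup>T" q n X q w] X w by (simp add: XtX)
  \<comment> \<open>\<open>w . w = (X^T vt) . w = vt . (X w) = vt . vt\<close>.\<close>
  then have "w \<bullet> w = 1"
    using transpose_vec_mult_scalar[OF X w(1) vt] w(2) vtvt by simp
  then interpret orthonormal_frame n q "n - q" X Xp vt w
    using X XtX w assms(6) real_orthogonal_hconcatD[OF X assms(6,7)]
    by unfold_locales auto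
  have "normal_basis ` normal_index
    = {X * outer_prod (unit_vec q i) (unit_vec q i) | i. i < q}
     \<union> {(1 / sqrt 2) \<cdot>\<^sub>m
           (X * (outer_prod (unit_vec q i) (unit_vec q j) + outer_prod (unit_vec q j) (unit_vec q i)))
         | i j. i < j \<and> j < q}
     \<union> {Xp * outer_prod (unit_vec (n - q) i) vt * X | i. i < n - q}" (is "_ = ?A \<union> ?B \<union> ?C")
  proof -
    have "normal_index = (\<lambda>i. Inl (i, i)) ` {..<q} \<union> Inl ` {(i, j). i < j \<and> j < q} \<union> Inr ` {..<n - q}"
      unfolding normal_index_def by force
    moreover have "normal_basis ` (\<lambda>i. Inl (i, i)) ` {..<q} = ?A"
      by (auto simp: image_iff normal_basis_Inl)
    moreover have "normal_basis ` Inl ` {(i, j). i < j \<and> j < q} = ?B"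
    proof -
      have "normal_basis ` Inl ` {(i, j). i < j \<and> j < q} = {normal_basis (Inl (i, j)) | i j. i < j \<and> j < q}"
        by blast
      also have "\<dots> = ?B"
        \<comment> \<open>\<open>rev_conj_cong\<close> supplies \<open>i < j\<close> while the
          matrix is rewritten, which selects the off-diagonal case.\<close>
        by (intro Collect_cong ex_cong1 rev_conj_cong refl) (simp add: normal_basis_Inl)
      finally show ?thesis .
    qed
    moreover have "normal_basis ` Inr ` {..<n - q} = ?C"
      unfolding image_image normal_basis_def sum.case by blast
    ultimately show ?thesis by (simp add: image_Un)
  qed
  then show ?thesis using normal_basis_is_orthonormal_basis unfolding Fv by simp
qed

end
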